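(* Let $A\in\mathbb{R}^{p\times n}$, $C\in\mathbb{R}^{q\times n}$, $b\in\mathbb{R}^p$, $d\in\mathbb{R}^q$, and suppose that the binary set $\mathcal X:=\{x\in\{0,1\}^n\mid Ax=b,\ Cx\le d\}$ is nonempty. Let $$P:=\{x\in[0,1]^n\mid Ax=b,\ Cx\le d\}$$ be its linear programming relaxation, and let $$S:=\Bigl\{(Y,s)\in\mathbb{S}^{n+1}_+\times\mathbb{R}^q_+\ \Big|\ Y=\begin{pmatrix} Y_{00} & x^T \\ x & X \end{pmatrix},\ Y_{00}=1,\ \operatorname{diag}(X)=x,\ Ax=b,\ Cx+s=d\Bigr\}$$ be its Shor relaxation, where $x\in\mathbb{R}^n$ and $X\in\mathbb{S}^n$ are the blocks of $Y$. Then the singularity degree of $S$, computed with respect to the product cone $\mathbb{S}^{n+1}_+\times\mathbb{R}^q_+$ and the displayed affine constraints, is at most one. More precisely, $$\operatorname{sd}(S)=\begin{cases}0,&\text{if there exists }x\in P\text{ such that }0<x<\mathbf 1\text{ and }Cx<d,\\ 1,&\text{otherwise,}\end{cases}$$ where the strict vector inequalities are componentwise and $\mathbf 1$ is the all-ones vector.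
   Context: $\mathbb{S}^k$ is the space of real symmetric $k\times k$ matrices with the trace inner product, $\mathbb{S}^k_+$ its cone of positive semidefinite matrices, $\mathbb{R}^q_+$ the nonnegative orthant, and $\operatorname{diag}(X)$ the vector of diagonal entries of $X$. Rows and columns of matrices in $\mathbb{S}^{n+1}$ are indexed by $0,1,\ldots,n$. Singularity degree. Let $K$ be a closed, full-dimensional, self-dual convex cone in a finite-dimensional inner-product space (here $K=\mathbb{S}^{n+1}_+\times\mathbb{R}^q_+$), and let $\mathcal F=\{z\in K\mid \mathcal A(z)=g\}$ be nonempty, where $\mathcal A$ is a linear map into some $\mathbb{R}^m$ with adjoint $\mathcal A^*$ and $g\in\mathbb{R}^m$. The minimal face of $\mathcal F$ is the smallest face of $K$ containing $\mathcal F$. Given a face $F$ of $K$ with $\mathcal F\subseteq F$, a facial-reduction step at $F$ consists of choosing $y\in\mathbb{R}^m$ with $g^Ty=0$ such that $w:=\mathcal A^*(y)$ satisfies $\langle w,z\rangle\ge 0$ for all $z\in F$ and $\langle w,z\rangle\neq 0$ for some $z\in F$, and replacing $F$ by the strictly smaller face $F\cap w^\perp$, which still contains $\mathcal F$. (For $F=K$ this says $\mathcal A^*(y)\in K\setminus\{0\}$ and $g^Ty=0$.) The singularity degree $\operatorname{sd}(\mathcal F)$ is the smallest number of successive facial-reduction steps, starting from $F=K$, needed to reach the minimal face. It is $0$ exactly when Slater's condition $\mathcal F\cap\operatorname{ri}(K)\neq\emptyset$ holds. For $S$, the system $\mathcal A(z)=g$ consists of the scalar equations $Y_{00}=1$;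 $X_{ii}-x_i=0$ ($i=1,\ldots,n$); $Ax=b$; $Cx+s=d$, in the variable $z=(Y,s)$. *)

theory Defs
  imports "HOL-Analysis.Analysis" "HOL-Library.Extended_Nat"
begin

section \<open>Facial reduction and singularity degree\<close>

text \<open>
  The ambient inner-product space is a subspace \<open>V\<close> of a Euclidean space (so that the space of
  symmetric matrices can be used with the inherited inner product), and \<open>K \<subseteq> V\<close> is the cone.
  The linear map \<open>L\<close> is only relevant on \<open>V\<close>; its adjoint takes values in \<open>V\<close>.
\<close>

definition adjoint_on ::
  "'v::euclidean_space set \<Rightarrow> ('v \<Rightarrow> 'w::euclidean_space) \<Rightarrow> 'w \<Rightarrow> 'v" where
  "adjoint_on V L y = (THE w. w \<in> V \<and> (\<forall>z\<in>V. w \<bullet> z = y \<bullet> L z))"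

definition feasible_set ::
  "'v::euclidean_space set \<Rightarrow> ('v \<Rightarrow> 'w::euclidean_space) \<Rightarrow> 'w \<Rightarrow> 'v set" where
  "feasible_set K L g = {z \<in> K. L z = g}"

definition minimal_face :: "'v::euclidean_space set \<Rightarrow> 'v set \<Rightarrow> 'v set" where
  "minimal_face K S = (\<lambda>F. F face_of K) hull S"

definition facial_reduction_step ::
  "'v::euclidean_space set \<Rightarrow> ('v \<Rightarrow> 'w::euclidean_space) \<Rightarrow> 'w \<Rightarrow> 'v set \<Rightarrow> 'v set \<Rightarrow> bool" where
  "facial_reduction_step V L g F F' \<longleftrightarrow>
     (\<exists>y. g \<bullet> y = 0 \<and>
       (\<forall>z\<in>F. 0 \<le> adjoint_on V L y \<bullet> z) \<and>
       (\<exists>z\<in>F. adjoint_on V L y \<bullet> z \<noteq> 0) \<and>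
       F' = F \<inter> {z. adjoint_on V L y \<bullet> z = 0})"

text \<open>
  The value is an extended natural number: it would be \<open>\<infinity>\<close> if the minimal face could not be
  reached, so a finite value includes the claim that it is reached.
\<close>

definition singularity_degree ::
  "'v::euclidean_space set \<Rightarrow> 'v set \<Rightarrow> ('v \<Rightarrow> 'w::euclidean_space) \<Rightarrow> 'w \<Rightarrow> enat" where
  "singularity_degree V K L g =
     (INF k \<in> {k. (facial_reduction_step V L g ^^ k) K (minimal_face K (feasible_set K L g))}. enat k)"

lemma adjoint_on:
  fixes L :: "'v::euclidean_space \<Rightarrow> 'w::euclidean_space"
  assumes V: "subspace V" and L: "linear L"
  shows "adjoint_on V L y \<in> V" and "z \<in> V \<Longrightarrow> adjoint_on V L y \<bullet> z = y \<bullet> L z"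
proof -
  obtain u v where u: "u \<in> span V" and v: "\<And>w. w \<in> span V \<Longrightarrow> orthogonal v w"
    and uv: "adjoint L y = u + v"
    using orthogonal_subspace_decomp_exists by metis
  have uV: "u \<in> V"
    using u V by (metis span_eq_iff)
  have eq: "u \<bullet> z = y \<bullet> L z" if "z \<in> V" for z
  proof -
    have "v \<bullet> z = 0"
      using v[of z] that by (simp add: orthogonal_def span_base)
    then have "u \<bullet> z = adjoint L y \<bullet> z"
      by (simp add: uv inner_add_left)
    also have "\<dots> = y \<bullet> L z"
      using adjoint_works[OF L, of z y] by (simp add: inner_commute)
    finally show ?thesis .
  qed
  have "\<exists>!w. w \<in> V \<and> (\<forall>z\<in>V. w \<bullet> z = y \<bullet> L z)"
  proof (rule ex1I[of _ u])
    fix w assume w: "w \<in> V \<and> (\<forall>z\<in>V. w \<bullet> z = y \<bullet> L z)"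
    have "w - u \<in> V"
      using w uV V by (simp add: subspace_diff)
    then have "(w - u) \<bullet> (w - u) = 0"
      using w eq by (simp add: inner_diff_left)
    then show "w = u"
      by simp
  qed (use uV eq in auto)
  from theI'[OF this] show "adjoint_on V L y \<in> V"
    and "z \<in> V \<Longrightarrow> adjoint_on V L y \<bullet> z = y \<bullet> L z"
    unfolding adjoint_on_def by auto
qed


section \<open>The binary set and its two relaxations\<close>

text \<open>
  The rows of the equality system are indexed by \<open>I :: 'p set\<close> and those of the inequality system
  by \<open>J :: 'q set\<close>, with \<open>'p\<close>, \<open>'q\<close> finite; thus $p$ is \<open>card I\<close> and $q$ is \<open>card J\<close>, and systems
  without equations or without inequalities are included. Entries of \<open>A\<close>, \<open>b\<close> outside \<open>I\<close> and
  of \<open>C\<close>, \<open>d\<close> outside \<open>J\<close> play no role. \<open>I = UNIV\<close> and \<open>J = UNIV\<close> give full matrices.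
  The space of real vectors indexed by \<open>J\<close> is the set of vectors supported on \<open>J\<close>.
\<close>

definition vecs_on :: "'q set \<Rightarrow> (real^'q::finite) set" where
  "vecs_on J = {s. \<forall>j. j \<notin> J \<longrightarrow> s $ j = 0}"

definition restrict_vec :: "'q set \<Rightarrow> real^'q::finite \<Rightarrow> real^'q" where
  "restrict_vec J v = (\<chi> j. if j \<in> J then v $ j else 0)"

definition binary_set ::
  "'p set \<Rightarrow> real^'n^'p \<Rightarrow> real^'p \<Rightarrow> 'q set \<Rightarrow> real^'n^'q \<Rightarrow> real^'q \<Rightarrow> (real^'n) set" where
  "binary_set I A b J C d =
     {x. (\<forall>i. x $ i \<in> {0, 1}) \<and> (\<forall>i\<in>I. (A *v x) $ i = b $ i) \<and> (\<forall>j\<in>J. (C *v x) $ j \<le> d $ j)}"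

definition lp_relaxation ::
  "'p set \<Rightarrow> real^'n^'p \<Rightarrow> real^'p \<Rightarrow> 'q set \<Rightarrow> real^'n^'q \<Rightarrow> real^'q \<Rightarrow> (real^'n) set" where
  "lp_relaxation I A b J C d =
     {x. (\<forall>i. x $ i \<in> {0..1}) \<and> (\<forall>i\<in>I. (A *v x) $ i = b $ i) \<and> (\<forall>j\<in>J. (C *v x) $ j \<le> d $ j)}"

text \<open>
  On symmetric matrices the inherited inner product of \<open>real^'k^'k\<close> is the trace inner product.
\<close>

definition sym_matrices :: "(real^'k^'k) set" where
  "sym_matrices = {Y. transpose Y = Y}"

definition psd_cone :: "(real^'k^'k) set" where
  "psd_cone = {Y \<in> sym_matrices. \<forall>v. 0 \<le> v \<bullet> (Y *v v)}"

definition nonneg_orthant :: "'q set \<Rightarrow> (real^'q::finite) set" where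
  "nonneg_orthant J = {s \<in> vecs_on J. \<forall>j\<in>J. 0 \<le> s $ j}"

text \<open>
  The index set \<open>{0, 1, \<dots>, n}\<close> is \<open>'n option\<close>, with \<open>None\<close> in the role of index 0.
  The next two definitions are the blocks $x$ and $X$ of $Y$.
\<close>

definition block_vec :: "real^('n option)^('n::finite option) \<Rightarrow> real^'n" where
  "block_vec Y = (\<chi> i. Y $ Some i $ None)"

definition block_mat :: "real^('n option)^('n::finite option) \<Rightarrow> real^'n^'n" where
  "block_mat Y = (\<chi> i j. Y $ Some i $ Some j)"

definition diag_vec :: "real^'n^'n \<Rightarrow> real^'n" where
  "diag_vec X = (\<chi> i. X $ i $ i)"

definition shor_relaxation ::
  "'p set \<Rightarrow> real^'n^'p \<Rightarrow> real^'p \<Rightarrow> 'q set \<Rightarrow> real^'n^'q \<Rightarrow> real^'q \<Rightarrow>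
    ((real^('n option)^('n option)) \<times> (real^'q)) set" where
  "shor_relaxation I A b J C d =
     {(Y, s). Y \<in> psd_cone \<and> s \<in> nonneg_orthant J \<and>
        Y $ None $ None = 1 \<and> diag_vec (block_mat Y) = block_vec Y \<and>
        (\<forall>i\<in>I. (A *v block_vec Y) $ i = b $ i) \<and>
        (\<forall>j\<in>J. (C *v block_vec Y) $ j + s $ j = d $ j)}"

definition shor_space :: "'q set \<Rightarrow> ((real^('n option)^('n::finite option)) \<times> (real^'q::finite)) set" where
  "shor_space J = sym_matrices \<times> vecs_on J"

definition shor_cone :: "'q set \<Rightarrow> ((real^('n option)^('n::finite option)) \<times> (real^'q::finite)) set" where
  "shor_cone J = psd_cone \<times> nonneg_orthant J"

text \<open>
  The coordinates outside \<open>I\<close> and \<open>J\<close> of the last two components are the trivial equations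
  \<open>0 = 0\<close>; they have no influence on the adjoint or on the condition \<open>g \<bullet> y = 0\<close>.
\<close>

definition shor_map ::
  "'p set \<Rightarrow> real^'n^'p \<Rightarrow> 'q set \<Rightarrow> real^'n^'q \<Rightarrow> (real^('n option)^('n option)) \<times> (real^'q) \<Rightarrow>
    real \<times> (real^'n) \<times> (real^'p) \<times> (real^'q)" where
  "shor_map I A J C = (\<lambda>(Y, s).
     (Y $ None $ None,
      diag_vec (block_mat Y) - block_vec Y,
      restrict_vec I (A *v block_vec Y),
      restrict_vec J (C *v block_vec Y + s)))"

definition shor_rhs ::
  "'p set \<Rightarrow> real^'p \<Rightarrow> 'q set \<Rightarrow> real^'q \<Rightarrow> real \<times> (real^'n) \<times> (real^'p) \<times> (real^'q)" where
  "shor_rhs I b J d = (1, 0, restrict_vec I b, restrict_vec J d)"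

lemma shor_relaxation_eq:
  "shor_relaxation I A b J C d = feasible_set (shor_cone J) (shor_map I A J C) (shor_rhs I b J d)"
  by (auto simp: shor_relaxation_def feasible_set_def shor_cone_def shor_map_def shor_rhs_def
      restrict_vec_def vec_eq_iff split: if_splits)

lemma linear_shor_map: "linear (shor_map I A J C)"
  by (rule linearI)
    (auto simp: shor_map_def restrict_vec_def diag_vec_def block_mat_def block_vec_def
      matrix_vector_mult_def vec_eq_iff algebra_simps sum.distrib sum_distrib_left)

lemma subspace_shor_space: "subspace (shor_space J)"
  by (auto simp: subspace_def shor_space_def sym_matrices_def vecs_on_def transpose_def vec_eq_iff
      zero_prod_def)

lemma shor_cone_subset: "shor_cone J \<subseteq> shor_space J"
  by (auto simp: shor_cone_def shor_space_def psd_cone_def nonneg_orthant_def)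

lemma sym_matrices_inner:
  assumes "X \<in> sym_matrices"
  shows "X \<bullet> Y = trace (X ** Y)"
proof -
  have s: "X $ i $ j = X $ j $ i" for i j
    using assms by (metis (mono_tags, lifting) mem_Collect_eq sym_matrices_def transpose_def vec_lambda_beta)
  have "X \<bullet> Y = (\<Sum>i\<in>UNIV. \<Sum>j\<in>UNIV. X $ j $ i * Y $ i $ j)"
    unfolding inner_vec_def by (simp add: s)
  also have "\<dots> = (\<Sum>j\<in>UNIV. \<Sum>i\<in>UNIV. X $ j $ i * Y $ i $ j)"
    by (rule sum.swap)
  finally show ?thesis
    by (simp add: trace_def matrix_matrix_mult_def)
qed

end

theory Submission
  imports Defs
begin

text \<open>
  Every \<open>x\<close> in the linear relaxation \<open>P\<close> lifts to the feasible matrix with blocks \<open>1\<close>, \<open>x\<close> and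
  \<open>X = x x\<^sup>T + Diag (x - x\<^sup>2)\<close>. Subtracting from this lift a small multiple of a cone element that
  vanishes on the constraints tight at \<open>x\<close> (\<open>Y\<^sub>i\<^sub>i = 0\<close> if \<open>x\<^sub>i = 0\<close>, \<open>Y\<^sub>0\<^sub>0 - 2 Y\<^sub>i\<^sub>0 + Y\<^sub>i\<^sub>i = 0\<close> if
  \<open>x\<^sub>i = 1\<close>, \<open>s\<^sub>j = 0\<close> if the \<open>j\<close>-th slack is \<open>0\<close>) stays in the cone, so all such elements belong to
  the minimal face. Conversely, for \<open>x\<close> in the relative interior of \<open>P\<close> the constraints tight at \<open>x\<close>
  are tight on all of \<open>P\<close>, and Farkas' lemma yields multipliers, positive on every tight constraint,
  for which the combination of the constraints vanishes identically. Since the equations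
  \<open>X\<^sub>i\<^sub>i = x\<^sub>i\<close> turn \<open>x\<^sub>i\<close> and \<open>1 - x\<^sub>i\<close> into \<open>Y\<^sub>i\<^sub>i\<close> and \<open>Y\<^sub>0\<^sub>0 - 2 Y\<^sub>i\<^sub>0 + Y\<^sub>i\<^sub>i\<close>, these multipliers give
  one exposing vector that cuts out exactly the minimal face.
\<close>

section \<open>Faces and closed convex cones\<close>

text \<open>What remains of \<open>a\<close> after subtracting a small multiple of \<open>z\<close>
  rescales to a point of \<open>K\<close> such that \<open>a\<close> lies strictly between it and
  \<open>z\<close>; the definition of a face then applies.\<close>

lemma face_of_absorbs_subtractable:
  fixes K :: "'a::real_vector set"
  assumes F: "F face_of K" and cone: "convex_cone K"
    and a: "a \<in> F" and z: "z \<in> K" and e: "0 < e" and az: "a - e *\<^sub>R z \<in> K"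
  shows "z \<in> F"
proof (cases "z = a")
  case True
  then show ?thesis using a by simp
next
  case False
  have aK: "a \<in> K"
    using F a by (auto simp: face_of_def)
  \<comment> \<open>\<open>r\<close> stays below 1 so that the remainder can be divided by
    \<open>1 - r\<close>, and does not exceed \<open>e\<close> so that the remainder is a convex
    combination of \<open>a\<close> and the given point.\<close>
  define r where "r = min e (1/2)"
  have r: "0 < r" "r < 1" "r \<le> e"
    using e by (auto simp: r_def)
  have "(r/e) *\<^sub>R (a - e *\<^sub>R z) + (1 - r/e) *\<^sub>R a \<in> K"
    using cone az aK r e by (intro convex_cone_add convex_cone_scaleR) auto
  moreover have "(r/e) *\<^sub>R (a - e *\<^sub>R z) + (1 - r/e) *\<^sub>R a = a - r *\<^sub>R z"
    using e by (simp add: algebra_simps)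
  ultimately have "a - r *\<^sub>R z \<in> K" by simp
  then have uK: "(1 / (1 - r)) *\<^sub>R (a - r *\<^sub>R z) \<in> K" (is "?u \<in> K")
    using cone r by (intro convex_cone_scaleR) auto
  have a_eq: "a = (1 - r) *\<^sub>R ?u + r *\<^sub>R z"
    using r by simp
  have "?u \<noteq> z"
  proof
    assume "?u = z"
    with a_eq have "a = (1 - r) *\<^sub>R z + r *\<^sub>R z" by simp
    then have "a = z" by (simp add: algebra_simps)
    with False show False by simp
  qed
  with a_eq r have "a \<in> open_segment ?u z"
    by (auto simp: in_segment)
  with F uK z a show ?thesis
    unfolding face_of_def by blast
qed

text \<open>Farkas' lemma in conic form: a finitely generated cone is closed, so a point outside it
  could be strictly separated, by a functional that is nonnegative on \<open>G\<close> and negative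
  at \<open>p\<close>.\<close>

lemma mem_finite_convex_cone_hull:
  fixes G :: "'a::euclidean_space set"
  assumes "finite G" and dual: "\<And>a. (\<And>g. g \<in> G \<Longrightarrow> 0 \<le> a \<bullet> g) \<Longrightarrow> 0 \<le> a \<bullet> p"
  shows "p \<in> convex_cone hull G"
proof (rule ccontr)
  assume "p \<notin> convex_cone hull G"
  then obtain a c where a: "a \<bullet> p < c" "\<And>x. x \<in> convex_cone hull G \<Longrightarrow> c < a \<bullet> x"
    using separating_hyperplane_closed_point[OF convex_convex_cone_hull closed_convex_cone_hull]
      \<open>finite G\<close> by metis
  have c: "c < 0"
    using a(2)[OF convex_cone_hull_contains_0] by simp
  have "0 \<le> a \<bullet> g" if "g \<in> G" for g
  proof (rule ccontr)
    assume "\<not> 0 \<le> a \<bullet> g"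
    then have neg: "a \<bullet> g < 0" by simp
    \<comment> \<open>This multiple of \<open>g\<close> has inner product exactly \<open>c\<close>
      with \<open>a\<close>, against the strict inequality.\<close>
    have "(c / (a \<bullet> g)) *\<^sub>R g \<in> convex_cone hull G"
      using that neg c by (intro convex_cone_hull_mul hull_inc) (auto simp: divide_nonpos_neg)
    from a(2)[OF this] show False
      using neg by simp
  qed
  from dual[OF this] a(1) c show False by simp
qed

text \<open>The segment from \<open>x\<close> to \<open>z\<close> can be prolonged beyond
  \<open>z\<close> inside \<open>S\<close>. An affine function that is positive at \<open>x\<close>
  and zero at \<open>z\<close> would be negative there.\<close>

lemma rel_interior_zero_imp_zero:
  fixes S :: "'a::euclidean_space set" and f :: "'a \<Rightarrow> real"
  assumes "convex S" and z: "z \<in> rel_interior S"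
    and f: "\<And>e x. f ((1 - e) *\<^sub>R x + e *\<^sub>R z) = (1 - e) * f x + e * f z"
    and nonneg: "\<And>x. x \<in> S \<Longrightarrow> 0 \<le> f x" and "f z = 0" and x: "x \<in> S"
  shows "f x = 0"
proof -
  have "S \<noteq> {}" using x by blast
  then obtain e where e: "e > 1" "(1 - e) *\<^sub>R x + e *\<^sub>R z \<in> S"
    using convex_rel_interior_iff[OF \<open>convex S\<close>] z x by blast
  have "0 \<le> (1 - e) * f x"
    using nonneg[OF e(2)] f \<open>f z = 0\<close> by simp
  with e(1) have "f x \<le> 0"
    by (simp add: zero_le_mult_iff)
  with nonneg[OF x] show ?thesis by simp
qed

section \<open>Positive semidefinite matrices\<close>

lemma sym_matrices_iff: "Y \<in> sym_matrices \<longleftrightarrow> (\<forall>i j. Y $ i $ j = Y $ j $ i)"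
  by (auto simp: sym_matrices_def transpose_def vec_eq_iff)

lemma psd_cone_add:
  assumes "X \<in> psd_cone" "Y \<in> psd_cone" shows "X + Y \<in> psd_cone"
  using assms
  by (auto simp: psd_cone_def sym_matrices_iff matrix_vector_mult_add_rdistrib inner_add_right)

lemma psd_cone_scaleR:
  assumes "0 \<le> c" "Y \<in> psd_cone" shows "c *\<^sub>R Y \<in> psd_cone"
  using assms
  by (auto simp: psd_cone_def sym_matrices_iff simp flip: scaleR_matrix_vector_assoc)

lemma zero_in_psd_cone: "0 \<in> psd_cone"
  by (auto simp: psd_cone_def sym_matrices_iff)

lemma convex_cone_shor_cone: "convex_cone (shor_cone J)"
  unfolding convex_cone_iff
  by (auto simp: shor_cone_def psd_cone_add psd_cone_scaleR zero_in_psd_cone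
      nonneg_orthant_def vecs_on_def zero_prod_def)

text \<open>Parallelogram identity for the form of \<open>Y\<close>, with the nonnegative term of
  \<open>u - v\<close> dropped.\<close>

lemma psd_add_le:
  assumes "Y \<in> psd_cone"
  shows "(u + v) \<bullet> (Y *v (u + v)) \<le> 2 * (u \<bullet> (Y *v u)) + 2 * (v \<bullet> (Y *v v))"
proof -
  have "0 \<le> (u - v) \<bullet> (Y *v (u - v))"
    using assms by (auto simp: psd_cone_def)
  then show ?thesis
    by (simp add: matrix_vector_right_distrib matrix_vector_mult_diff_distrib
        inner_add_left inner_add_right inner_diff_left inner_diff_right)
qed

text \<open>Each new summand costs a factor 2. The bound is crude, but later it only matters that
  the factor is independent of the vectors.\<close>

lemma psd_sum_le:
  assumes Y: "Y \<in> psd_cone" and "finite S"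
  shows "(\<Sum>i\<in>S. a i) \<bullet> (Y *v (\<Sum>i\<in>S. a i)) \<le> 2 ^ card S * (\<Sum>i\<in>S. a i \<bullet> (Y *v a i))"
  using \<open>finite S\<close>
proof (induction S)
  case empty
  then show ?case by simp
next
  case (insert k S)
  have q: "0 \<le> a k \<bullet> (Y *v a k)"
    using Y by (auto simp: psd_cone_def)
  have "2 * (a k \<bullet> (Y *v a k)) \<le> 2 ^ Suc (card S) * (a k \<bullet> (Y *v a k))"
    using q by (intro mult_right_mono) auto
  with psd_add_le[OF Y, of "a k" "sum a S"] insert show ?case
    by (simp add: algebra_simps)
qed

section \<open>Quadratic forms of matrices indexed by 0, ..., n\<close>

lemma sum_option: "(\<Sum>k\<in>UNIV. f k) = f None + (\<Sum>i\<in>UNIV. f (Some i))"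
  for f :: "'n::finite option \<Rightarrow> 'a::comm_monoid_add"
  by (simp add: UNIV_option_conv sum.reindex)

lemma quadratic_form_option:
  fixes Y :: "real^('n::finite option)^('n option)"
  shows "v \<bullet> (Y *v v) = v $ None * (Y $ None $ None * v $ None + (\<Sum>j\<in>UNIV. Y $ None $ Some j * v $ Some j))
     + (\<Sum>i\<in>UNIV. v $ Some i * (Y $ Some i $ None * v $ None + (\<Sum>j\<in>UNIV. Y $ Some i $ Some j * v $ Some j)))"
  by (simp add: inner_vec_def matrix_vector_mult_def sum_option)

text \<open>The values \<open>c = 0\<close> and \<open>c = 1\<close> yield the two expressions that
  replace \<open>x $ i\<close> and \<open>1 - x $ i\<close> in the cone; the domination by the lift
  takes \<open>c = x $ i\<close>.\<close>

lemma quadratic_form_axis_diff: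
  fixes Y :: "real^('n::finite option)^('n option)"
  assumes "Y \<in> sym_matrices"
  shows "(axis (Some i) 1 - c *\<^sub>R axis None 1) \<bullet> (Y *v (axis (Some i) 1 - c *\<^sub>R axis None 1))
     = Y $ Some i $ Some i - 2 * c * Y $ Some i $ None + c\<^sup>2 * Y $ None $ None"
  using assms
  by (simp add: inner_axis' matrix_vector_mult_basis column_def sym_matrices_iff
      power2_eq_square algebra_simps)

section \<open>Lifts of points of the unit box\<close>

definition shor_lift :: "real^'n \<Rightarrow> real^('n option)^('n::finite option)" where
  "shor_lift x = (\<chi> k l. case (k, l) of
      (None, None) \<Rightarrow> 1
    | (None, Some j) \<Rightarrow> x $ j
    | (Some i, None) \<Rightarrow> x $ i
    | (Some i, Some j) \<Rightarrow> (if i = j then x $ i else x $ i * x $ j))"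

lemma shor_lift_simps [simp]:
  "shor_lift x $ None $ None = 1"
  "shor_lift x $ None $ Some j = x $ j"
  "shor_lift x $ Some i $ None = x $ i"
  "shor_lift x $ Some i $ Some j = (if i = j then x $ i else x $ i * x $ j)"
  by (simp_all add: shor_lift_def)

lemma block_shor_lift [simp]:
  "block_vec (shor_lift x) = x" "diag_vec (block_mat (shor_lift x)) = x"
  by (simp_all add: block_vec_def block_mat_def diag_vec_def vec_eq_iff)

text \<open>The first square is the rank-one form of the vector (1, x), the sum is the diagonal
  correction. On the unit box the lift is the second-moment matrix of 1 and independent Bernoulli
  variables with means \<open>x $ i\<close>.\<close>

lemma quadratic_form_shor_lift:
  fixes x :: "real^'n"
  shows "v \<bullet> (shor_lift x *v v) =
    (v $ None + (\<Sum>i\<in>UNIV. x $ i * v $ Some i))\<^sup>2 + (\<Sum>i\<in>UNIV. (x $ i - (x $ i)\<^sup>2) * (v $ Some i)\<^sup>2)"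
proof -
  let ?p = "\<Sum>j\<in>UNIV. x $ j * v $ Some j"
  have row: "(\<Sum>j\<in>UNIV. (if i = j then x $ i else x $ i * x $ j) * v $ Some j)
      = x $ i * ?p + (x $ i - (x $ i)\<^sup>2) * v $ Some i" for i
  proof -
    have "(\<Sum>j\<in>UNIV. (if i = j then x $ i else x $ i * x $ j) * v $ Some j)
        = (\<Sum>j\<in>UNIV. x $ i * (x $ j * v $ Some j)
             + (if i = j then (x $ i - (x $ i)\<^sup>2) * v $ Some i else 0))"
      by (intro sum.cong) (auto simp: power2_eq_square algebra_simps)
    then show ?thesis
      by (simp add: sum.distrib sum_distrib_left)
  qed
  have "v \<bullet> (shor_lift x *v v) = v $ None * (v $ None + ?p)
      + (\<Sum>i\<in>UNIV. v $ Some i * (x $ i * v $ None + (x $ i * ?p + (x $ i - (x $ i)\<^sup>2) * v $ Some i)))"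
    by (simp add: quadratic_form_option row)
  also have "(\<Sum>i\<in>UNIV. v $ Some i * (x $ i * v $ None + (x $ i * ?p + (x $ i - (x $ i)\<^sup>2) * v $ Some i)))
      = (\<Sum>i\<in>UNIV. (v $ None + ?p) * (x $ i * v $ Some i) + (x $ i - (x $ i)\<^sup>2) * (v $ Some i)\<^sup>2)"
    by (intro sum.cong) (auto simp: power2_eq_square algebra_simps)
  also have "\<dots> = (v $ None + ?p) * ?p + (\<Sum>i\<in>UNIV. (x $ i - (x $ i)\<^sup>2) * (v $ Some i)\<^sup>2)"
    by (simp add: sum.distrib sum_distrib_left)
  finally show ?thesis
    by (simp add: power2_eq_square algebra_simps)
qed

lemma unit_interval_variance: "0 \<le> t - t\<^sup>2" if "t \<in> {0..1}" for t :: real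
  using that mult_left_mono[of t 1 t] by (auto simp: power2_eq_square)

lemma shor_lift_psd:
  assumes "\<And>i. x $ i \<in> {0..1}"
  shows "shor_lift x \<in> psd_cone"
proof -
  have "0 \<le> v \<bullet> (shor_lift x *v v)" for v
    unfolding quadratic_form_shor_lift
    using assms by (intro add_nonneg_nonneg sum_nonneg mult_nonneg_nonneg unit_interval_variance) auto
  moreover have "shor_lift x \<in> sym_matrices"
    unfolding sym_matrices_iff
  proof (intro allI)
    fix k l :: "'a option"
    show "shor_lift x $ k $ l = shor_lift x $ l $ k"
      by (cases k; cases l) (auto simp: algebra_simps)
  qed
  ultimately show ?thesis by (auto simp: psd_cone_def)
qed

text \<open>
  The bound comes from \<open>v = (v\<^sub>0 + x \<bullet> u) e\<^sub>0 + (\<Sum>i. u\<^sub>i (e\<^sub>i - x\<^sub>i e\<^sub>0))\<close>: for binary \<open>x\<^sub>i\<close>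
  the form \<open>Y\<close> vanishes on \<open>e\<^sub>i - x\<^sub>i e\<^sub>0\<close>, and the remaining coefficients are exactly the
  squares that make up the quadratic form of \<open>shor_lift x\<close>.
\<close>

lemma psd_dominated_by_shor_lift:
  fixes x :: "real^'n"
  assumes x: "\<And>i. x $ i \<in> {0..1}" and Y: "Y \<in> psd_cone"
    and Y0: "\<And>i. x $ i = 0 \<Longrightarrow> Y $ Some i $ Some i = 0"
    and Y1: "\<And>i. x $ i = 1 \<Longrightarrow> Y $ None $ None - 2 * Y $ Some i $ None + Y $ Some i $ Some i = 0"
  shows "\<exists>c\<ge>0. \<forall>v. v \<bullet> (Y *v v) \<le> c * (v \<bullet> (shor_lift x *v v))"
proof -
  have sym: "Y \<in> sym_matrices" and nonneg: "\<And>v. 0 \<le> v \<bullet> (Y *v v)"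
    using Y by (auto simp: psd_cone_def)
  define f where "f i = axis (Some i) 1 - x $ i *\<^sub>R (axis None 1 :: real^('n option))" for i
  define q where "q i = f i \<bullet> (Y *v f i)" for i
  have q_eq: "q i = Y $ Some i $ Some i - 2 * x $ i * Y $ Some i $ None + (x $ i)\<^sup>2 * Y $ None $ None" for i
    unfolding q_def f_def by (rule quadratic_form_axis_diff[OF sym])
  have q0: "0 \<le> q i" for i
    unfolding q_def by (rule nonneg)
  have psd00: "0 \<le> Y $ None $ None"
    using nonneg[of "axis None 1"] by (simp add: matrix_vector_mult_basis column_def inner_axis')
  define r where "r i = x $ i - (x $ i)\<^sup>2" for i
  have r0: "0 \<le> r i" for i
    unfolding r_def by (rule unit_interval_variance[OF x])
  have qz: "q i = 0" if "r i = 0" for i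
  proof -
    have "x $ i * (1 - x $ i) = 0"
      using that by (simp add: r_def power2_eq_square algebra_simps)
    then have "x $ i = 0 \<or> x $ i = 1" by auto
    with Y0[of i] Y1[of i] show ?thesis
      by (auto simp: q_eq)
  qed
  \<comment> \<open>The sum of the ratios bounds each of them. Where \<open>r i = 0\<close> the
    quotient is 0 by convention, and \<open>q i\<close> vanishes too. The first summand lets
    \<open>m\<close> also bound the coefficient of the square of \<open>p\<close> below.\<close>
  define m where "m = Y $ None $ None + (\<Sum>i\<in>UNIV. q i / r i)"
  have frac: "0 \<le> q i / r i" for i
    using q0 r0 by simp
  have m00: "Y $ None $ None \<le> m"
    unfolding m_def using frac by (simp add: sum_nonneg)
  then have m0: "0 \<le> m" using psd00 by simp
  have qm: "q i \<le> m * r i" for i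
  proof (cases "r i = 0")
    case True
    then show ?thesis using qz by simp
  next
    case False
    have "q i / r i \<le> (\<Sum>i\<in>UNIV. q i / r i)"
      using frac by (intro member_le_sum) auto
    then have "q i / r i \<le> m"
      using psd00 by (simp add: m_def)
    then show ?thesis
      using False r0[of i] by (simp add: field_simps)
  qed
  \<comment> \<open>The factor of \<open>psd_sum_le\<close> for a sum of n + 1 vectors.\<close>
  define N where "N = (2::real) ^ CARD('n option)"
  have "v \<bullet> (Y *v v) \<le> N * m * (v \<bullet> (shor_lift x *v v))" for v
  proof -
    define p where "p = v $ None + (\<Sum>i\<in>UNIV. x $ i * v $ Some i)"
    define a where "a k = (case k of None \<Rightarrow> p *\<^sub>R axis None 1 | Some i \<Rightarrow> v $ Some i *\<^sub>R f i)" for k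
    have "v = (\<Sum>k\<in>UNIV. a k)"
    proof -
      have "(\<Sum>k\<in>UNIV. a k) $ l = v $ l" for l
      proof (cases l)
        case None
        have "(\<Sum>k\<in>UNIV. a k $ None) = p + (\<Sum>i\<in>UNIV. - (x $ i * v $ Some i))"
          by (simp add: sum_option a_def f_def axis_def algebra_simps)
        then show ?thesis by (simp add: None p_def sum_negf)
      next
        case (Some i)
        have "a None $ Some i = 0" "a (Some j) $ Some i = (if i = j then v $ Some j else 0)" for j
          by (auto simp: a_def f_def axis_def)
        then show ?thesis by (simp add: Some sum_option)
      qed
      then show ?thesis by (simp add: vec_eq_iff)
    qed
    then have "v \<bullet> (Y *v v) \<le> N * (\<Sum>k\<in>UNIV. a k \<bullet> (Y *v a k))"
      unfolding N_def using psd_sum_le[OF Y, of UNIV a] by simp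
    also have "(\<Sum>k\<in>UNIV. a k \<bullet> (Y *v a k)) = p\<^sup>2 * Y $ None $ None + (\<Sum>i\<in>UNIV. (v $ Some i)\<^sup>2 * q i)"
      by (simp add: sum_option a_def q_def matrix_vector_mult_scaleR matrix_vector_mult_basis
          column_def inner_axis' power2_eq_square mult.assoc)
    also have "\<dots> \<le> p\<^sup>2 * m + (\<Sum>i\<in>UNIV. (v $ Some i)\<^sup>2 * (m * r i))"
      using m00 qm by (intro add_mono mult_left_mono sum_mono) auto
    also have "\<dots> = m * (v \<bullet> (shor_lift x *v v))"
      by (simp add: quadratic_form_shor_lift p_def r_def sum_distrib_left algebra_simps)
    finally show ?thesis
      by (simp add: N_def mult.assoc)
  qed
  moreover have "0 \<le> N * m" using m0 by (simp add: N_def)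
  ultimately show ?thesis by blast
qed

text \<open>The matrix block and the slack block are each dominated up to a constant,
  \<open>c\<close> and \<open>k\<close>; one small \<open>e\<close> then serves both.\<close>

lemma shor_cone_dominated:
  fixes x :: "real^'n" and C :: "real^'n^'q" and d :: "real^'q"
  assumes x: "\<And>i. x $ i \<in> {0..1}" and slack: "\<And>j. j \<in> J \<Longrightarrow> (C *v x) $ j \<le> d $ j"
    and z: "(Y, s) \<in> shor_cone J"
    and Y0: "\<And>i. x $ i = 0 \<Longrightarrow> Y $ Some i $ Some i = 0"
    and Y1: "\<And>i. x $ i = 1 \<Longrightarrow> Y $ None $ None - 2 * Y $ Some i $ None + Y $ Some i $ Some i = 0"
    and s0: "\<And>j. j \<in> J \<Longrightarrow> (C *v x) $ j = d $ j \<Longrightarrow> s $ j = 0"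
  shows "\<exists>e>0. (shor_lift x, restrict_vec J (d - C *v x)) - e *\<^sub>R (Y, s) \<in> shor_cone J"
proof -
  have Y: "Y \<in> psd_cone" and s: "s \<in> nonneg_orthant J"
    using z by (auto simp: shor_cone_def)
  obtain c where c: "c \<ge> 0" "\<And>v. v \<bullet> (Y *v v) \<le> c * (v \<bullet> (shor_lift x *v v))"
    using psd_dominated_by_shor_lift[OF x Y Y0 Y1] by blast
  define w where "w j = d $ j - (C *v x) $ j" for j
  \<comment> \<open>As for the matrix block, the sum dominates every single ratio; a tight row
    contributes 0 because both its slack and \<open>s $ j\<close> vanish.\<close>
  define k where "k = (\<Sum>j\<in>J. s $ j / w j)"
  have frac: "0 \<le> s $ j / w j" if "j \<in> J" for j
    using s slack[OF that] that by (auto simp: nonneg_orthant_def w_def)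
  have k0: "0 \<le> k"
    unfolding k_def using frac by (intro sum_nonneg) auto
  have sk: "s $ j \<le> k * w j" if "j \<in> J" for j
  proof (cases "w j = 0")
    case True
    then show ?thesis using s0[OF that] by (simp add: w_def)
  next
    case False
    have "s $ j / w j \<le> k"
      unfolding k_def using frac that by (intro member_le_sum) auto
    then show ?thesis
      using False slack[OF that] by (simp add: w_def field_simps)
  qed
  \<comment> \<open>The summand 1 keeps the denominator positive when \<open>c\<close> and
    \<open>k\<close> are both 0.\<close>
  define e where "e = 1 / (1 + c + k)"
  have e: "0 < e" "e * c \<le> 1" "e * k \<le> 1"
    using c(1) k0 by (auto simp: e_def)
  have lift: "shor_lift x \<in> psd_cone"
    by (rule shor_lift_psd[OF x])
  have "e * (v \<bullet> (Y *v v)) \<le> v \<bullet> (shor_lift x *v v)" for v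
  proof -
    have "e * (v \<bullet> (Y *v v)) \<le> e * (c * (v \<bullet> (shor_lift x *v v)))"
      using c(2) e(1) by (intro mult_left_mono) auto
    also have "\<dots> = (e * c) * (v \<bullet> (shor_lift x *v v))" by simp
    also have "\<dots> \<le> 1 * (v \<bullet> (shor_lift x *v v))"
      using e(2) lift by (intro mult_right_mono) (auto simp: psd_cone_def)
    finally show ?thesis by simp
  qed
  then have "shor_lift x - e *\<^sub>R Y \<in> psd_cone"
    using Y lift
    by (auto simp: psd_cone_def sym_matrices_iff matrix_vector_mult_diff_rdistrib inner_diff_right
        simp flip: scaleR_matrix_vector_assoc)
  moreover have "e * s $ j \<le> w j" if "j \<in> J" for j
  proof -
    have "e * s $ j \<le> e * (k * w j)"
      using sk[OF that] e(1) by (intro mult_left_mono) auto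
    also have "\<dots> = (e * k) * w j" by simp
    also have "\<dots> \<le> 1 * w j"
      using e(3) slack[OF that] by (intro mult_right_mono) (auto simp: w_def)
    finally show ?thesis by simp
  qed
  then have "restrict_vec J (d - C *v x) - e *\<^sub>R s \<in> nonneg_orthant J"
    using s by (auto simp: nonneg_orthant_def vecs_on_def restrict_vec_def w_def)
  ultimately show ?thesis
    using e(1) by (auto simp: shor_cone_def)
qed

section \<open>Feasible lifts and elements of the minimal face\<close>

lemma shor_lift_feasible:
  assumes "x \<in> lp_relaxation I A b J C d"
  shows "(shor_lift x, restrict_vec J (d - C *v x)) \<in> shor_relaxation I A b J C d"
  using assms
  by (auto simp: shor_relaxation_def lp_relaxation_def nonneg_orthant_def vecs_on_def
      restrict_vec_def intro!: shor_lift_psd)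

text \<open>Every face containing the feasible set contains the lift of \<open>x\<close>, from which
  a positive multiple of \<open>(Y, s)\<close> can be subtracted within the cone; so the face
  absorbs \<open>(Y, s)\<close>.\<close>

lemma mem_minimal_face_shor:
  fixes A :: "real^'n^'p" and C :: "real^'n^'q"
  assumes x: "x \<in> lp_relaxation I A b J C d" and z: "(Y, s) \<in> shor_cone J"
    and Y0: "\<And>i. x $ i = 0 \<Longrightarrow> Y $ Some i $ Some i = 0"
    and Y1: "\<And>i. x $ i = 1 \<Longrightarrow> Y $ None $ None - 2 * Y $ Some i $ None + Y $ Some i $ Some i = 0"
    and s0: "\<And>j. j \<in> J \<Longrightarrow> (C *v x) $ j = d $ j \<Longrightarrow> s $ j = 0"
  shows "(Y, s) \<in> minimal_face (shor_cone J) (shor_relaxation I A b J C d)"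
  unfolding minimal_face_def hull_def
proof clarify
  fix F assume F: "F face_of shor_cone J" "shor_relaxation I A b J C d \<subseteq> F"
  have box: "x $ i \<in> {0..1}" for i
    using x by (simp add: lp_relaxation_def)
  have slack: "(C *v x) $ j \<le> d $ j" if "j \<in> J" for j
    using x that by (simp add: lp_relaxation_def)
  obtain e where "e > 0" "(shor_lift x, restrict_vec J (d - C *v x)) - e *\<^sub>R (Y, s) \<in> shor_cone J"
    using shor_cone_dominated[OF box slack z Y0 Y1 s0] by blast
  then show "(Y, s) \<in> F"
    using face_of_absorbs_subtractable[OF F(1) convex_cone_shor_cone] F(2) shor_lift_feasible[OF x] z
    by blast
qed

section \<open>A strictly complementary dual certificate for the linear relaxation\<close>

lemma convex_lp_relaxation: "convex (lp_relaxation I A b J C d)"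
proof (rule convexI)
  fix x y :: "real^'a" and u v :: real
  assume x: "x \<in> lp_relaxation I A b J C d" and y: "y \<in> lp_relaxation I A b J C d"
    and uv: "0 \<le> u" "0 \<le> v" "u + v = 1"
  have "u * s + v * t \<le> c" if "s \<le> c" "t \<le> c" for s t c :: real
    using convex_bound_le[OF that uv] .
  moreover have "u * c + v * c = c" for c :: real
    using uv by (simp flip: distrib_right)
  ultimately show "u *\<^sub>R x + v *\<^sub>R y \<in> lp_relaxation I A b J C d"
    using x y uv
    by (auto simp: lp_relaxation_def matrix_vector_right_distrib matrix_vector_mult_scaleR)
qed

text \<open>
  The variable \<open>t\<close> homogenizes the constraints; it later takes the value \<open>Y\<^sub>0\<^sub>0\<close>.
\<close>

definition lp_combination ::
  "'p set \<Rightarrow> real^'n^'p \<Rightarrow> real^'p \<Rightarrow> 'q set \<Rightarrow> real^'n^'q \<Rightarrow> real^'q \<Rightarrow>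
    real^'n \<Rightarrow> real^'n \<Rightarrow> real^'q \<Rightarrow> real^'p \<Rightarrow> real \<Rightarrow> real^'n \<Rightarrow> real \<Rightarrow> real" where
  "lp_combination I A b J C d \<alpha> \<beta> \<gamma> \<mu> \<kappa> x t =
     (\<Sum>i\<in>UNIV. \<alpha> $ i * x $ i) + (\<Sum>i\<in>UNIV. \<beta> $ i * (t - x $ i))
     + (\<Sum>j\<in>J. \<gamma> $ j * (t * d $ j - (C *v x) $ j))
     + (\<Sum>k\<in>I. \<mu> $ k * ((A *v x) $ k - t * b $ k)) + \<kappa> * t"

lemma lp_combination_add:
  "lp_combination I A b J C d (\<alpha> + \<alpha>') (\<beta> + \<beta>') (\<gamma> + \<gamma>') (\<mu> + \<mu>') (\<kappa> + \<kappa>') x t =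
   lp_combination I A b J C d \<alpha> \<beta> \<gamma> \<mu> \<kappa> x t + lp_combination I A b J C d \<alpha>' \<beta>' \<gamma>' \<mu>' \<kappa>' x t"
  by (simp add: lp_combination_def distrib_right sum.distrib)

lemma lp_combination_scaleR:
  "lp_combination I A b J C d (c *\<^sub>R \<alpha>) (c *\<^sub>R \<beta>) (c *\<^sub>R \<gamma>) (c *\<^sub>R \<mu>) (c * \<kappa>) x t =
   c * lp_combination I A b J C d \<alpha> \<beta> \<gamma> \<mu> \<kappa> x t"
  by (simp add: lp_combination_def distrib_left sum_distrib_left mult.assoc)

text \<open>At \<open>t = 1\<close> the inequality terms are nonnegative and the equality terms
  vanish, so at least \<kappa> remains. This later forces \<kappa> to be 0.\<close>

lemma lp_combination_nonneg:
  assumes "x \<in> lp_relaxation I A b J C d"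
    and "\<And>i. 0 \<le> \<alpha> $ i" "\<And>i. 0 \<le> \<beta> $ i" "\<And>j. j \<in> J \<Longrightarrow> 0 \<le> \<gamma> $ j"
  shows "\<kappa> \<le> lp_combination I A b J C d \<alpha> \<beta> \<gamma> \<mu> \<kappa> x 1"
  using assms unfolding lp_combination_def lp_relaxation_def
  by (auto intro!: add_nonneg_nonneg sum_nonneg mult_nonneg_nonneg)

lemma sum_affine:
  fixes f :: "'i \<Rightarrow> real" and F :: "'i \<Rightarrow> 'a::real_vector \<Rightarrow> real"
  assumes "\<And>i. F i ((1 - e) *\<^sub>R x + e *\<^sub>R z) = (1 - e) * F i x + e * F i z"
  shows "(\<Sum>i\<in>S. f i * F i ((1 - e) *\<^sub>R x + e *\<^sub>R z)) =
    (1 - e) * (\<Sum>i\<in>S. f i * F i x) + e * (\<Sum>i\<in>S. f i * F i z)"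
  by (simp add: assms sum_distrib_left flip: sum.distrib) (simp add: algebra_simps)

text \<open>Affinity in the form required by \<open>rel_interior_zero_imp_zero\<close>, where
  \<open>e\<close> may exceed 1.\<close>

lemma lp_combination_affine:
  fixes A :: "real^'n^'p" and C :: "real^'n^'q"
  shows "lp_combination I A b J C d \<alpha> \<beta> \<gamma> \<mu> \<kappa> ((1 - e) *\<^sub>R x + e *\<^sub>R z) 1 =
   (1 - e) * lp_combination I A b J C d \<alpha> \<beta> \<gamma> \<mu> \<kappa> x 1 + e * lp_combination I A b J C d \<alpha> \<beta> \<gamma> \<mu> \<kappa> z 1"
proof -
  have "(\<Sum>i\<in>UNIV. \<alpha> $ i * ((1 - e) *\<^sub>R x + e *\<^sub>R z) $ i) =
      (1 - e) * (\<Sum>i\<in>UNIV. \<alpha> $ i * x $ i) + e * (\<Sum>i\<in>UNIV. \<alpha> $ i * z $ i)"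
    by (rule sum_affine[where F = "\<lambda>i x. x $ i"]) simp
  moreover have "(\<Sum>i\<in>UNIV. \<beta> $ i * (1 - ((1 - e) *\<^sub>R x + e *\<^sub>R z) $ i)) =
      (1 - e) * (\<Sum>i\<in>UNIV. \<beta> $ i * (1 - x $ i)) + e * (\<Sum>i\<in>UNIV. \<beta> $ i * (1 - z $ i))"
    by (rule sum_affine[where F = "\<lambda>i x. 1 - x $ i"]) (simp add: algebra_simps)
  moreover have "(\<Sum>j\<in>J. \<gamma> $ j * (1 * d $ j - (C *v ((1 - e) *\<^sub>R x + e *\<^sub>R z)) $ j)) =
      (1 - e) * (\<Sum>j\<in>J. \<gamma> $ j * (1 * d $ j - (C *v x) $ j)) + e * (\<Sum>j\<in>J. \<gamma> $ j * (1 * d $ j - (C *v z) $ j))"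
    by (rule sum_affine[where F = "\<lambda>j x. 1 * d $ j - (C *v x) $ j"])
      (simp add: matrix_vector_right_distrib matrix_vector_mult_scaleR, simp add: algebra_simps)
  moreover have "(\<Sum>k\<in>I. \<mu> $ k * ((A *v ((1 - e) *\<^sub>R x + e *\<^sub>R z)) $ k - 1 * b $ k)) =
      (1 - e) * (\<Sum>k\<in>I. \<mu> $ k * ((A *v x) $ k - 1 * b $ k)) + e * (\<Sum>k\<in>I. \<mu> $ k * ((A *v z) $ k - 1 * b $ k))"
    by (rule sum_affine[where F = "\<lambda>k x. (A *v x) $ k - 1 * b $ k"])
      (simp add: matrix_vector_right_distrib matrix_vector_mult_scaleR, simp add: algebra_simps)
  ultimately show ?thesis
    unfolding lp_combination_def by (simp add: algebra_simps)
qed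

section \<open>Farkas' lemma for the linear relaxation\<close>

lemma sum_axis: "(\<Sum>i\<in>S. axis k 1 $ i * f i) = (if k \<in> S then f k else 0)"
  for f :: "'i::finite \<Rightarrow> real"
proof -
  have "(\<Sum>i\<in>S. axis k 1 $ i * f i) = (\<Sum>i\<in>S. if i = k then f i else 0)"
    by (intro sum.cong) (auto simp: axis_def)
  then show ?thesis by simp
qed

text \<open>The conic Farkas lemma is applied to the homogenized constraints. The feasible point
  \<open>xh\<close> takes care of dual vectors \<open>(v, 0)\<close>, which are recession directions
  and cannot be normalized to points of the relaxation.\<close>

lemma affine_farkas_lp_relaxation:
  fixes A :: "real^'n^'p" and C :: "real^'n^'q"
  assumes xh: "xh \<in> lp_relaxation I A b J C d"
    and p: "\<And>x. x \<in> lp_relaxation I A b J C d \<Longrightarrow> 0 \<le> p \<bullet> (x, 1::real)"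
  shows "\<exists>\<alpha> \<beta> \<gamma> \<mu> \<kappa>. (\<forall>i. 0 \<le> \<alpha> $ i) \<and> (\<forall>i. 0 \<le> \<beta> $ i) \<and> (\<forall>j\<in>J. 0 \<le> \<gamma> $ j) \<and> 0 \<le> \<kappa> \<and>
    (\<forall>x t. p \<bullet> (x, t) = lp_combination I A b J C d \<alpha> \<beta> \<gamma> \<mu> \<kappa> x t)"
proof -
  \<comment> \<open>The representable functionals. They form a convex cone containing the
    generators, hence contain the hull of the generators.\<close>
  define Q where "Q = {p. \<exists>\<alpha> \<beta> \<gamma> \<mu> \<kappa>. (\<forall>i. 0 \<le> \<alpha> $ i) \<and> (\<forall>i. 0 \<le> \<beta> $ i) \<and> (\<forall>j\<in>J. 0 \<le> \<gamma> $ j) \<and>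
    0 \<le> \<kappa> \<and> (\<forall>x t. p \<bullet> (x, t) = lp_combination I A b J C d \<alpha> \<beta> \<gamma> \<mu> \<kappa> x t)}"
  have Q: "q \<in> Q"
    if "\<And>x t. q \<bullet> (x, t) = lp_combination I A b J C d \<alpha> \<beta> \<gamma> \<mu> \<kappa> x t"
      "\<And>i. 0 \<le> \<alpha> $ i" "\<And>i. 0 \<le> \<beta> $ i" "\<And>j. j \<in> J \<Longrightarrow> 0 \<le> \<gamma> $ j" "0 \<le> \<kappa>"
    for q \<alpha> \<beta> \<gamma> \<mu> \<kappa>
    unfolding Q_def using that by blast
  have QE: "\<exists>\<alpha> \<beta> \<gamma> \<mu> \<kappa>. (\<forall>i. 0 \<le> \<alpha> $ i) \<and> (\<forall>i. 0 \<le> \<beta> $ i) \<and> (\<forall>j\<in>J. 0 \<le> \<gamma> $ j) \<and>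
    0 \<le> \<kappa> \<and> (\<forall>x t. q \<bullet> (x, t) = lp_combination I A b J C d \<alpha> \<beta> \<gamma> \<mu> \<kappa> x t)" if "q \<in> Q" for q
    using that unfolding Q_def by blast
  have "convex_cone Q"
    unfolding convex_cone_iff
  proof (intro conjI ballI allI impI)
    show "0 \<in> Q"
      by (rule Q[where \<alpha> = 0 and \<beta> = 0 and \<gamma> = 0 and \<mu> = 0 and \<kappa> = 0])
        (auto simp: lp_combination_def)
  next
    fix q r assume "q \<in> Q" "r \<in> Q"
    obtain \<alpha> \<beta> \<gamma> \<mu> \<kappa> where 1: "\<And>i. 0 \<le> \<alpha> $ i" "\<And>i. 0 \<le> \<beta> $ i" "\<And>j. j \<in> J \<Longrightarrow> 0 \<le> \<gamma> $ j" "0 \<le> \<kappa>"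
      "\<And>x t. q \<bullet> (x, t) = lp_combination I A b J C d \<alpha> \<beta> \<gamma> \<mu> \<kappa> x t"
      using QE[OF \<open>q \<in> Q\<close>] by blast
    obtain \<alpha>' \<beta>' \<gamma>' \<mu>' \<kappa>' where 2: "\<And>i. 0 \<le> \<alpha>' $ i" "\<And>i. 0 \<le> \<beta>' $ i" "\<And>j. j \<in> J \<Longrightarrow> 0 \<le> \<gamma>' $ j" "0 \<le> \<kappa>'"
      "\<And>x t. r \<bullet> (x, t) = lp_combination I A b J C d \<alpha>' \<beta>' \<gamma>' \<mu>' \<kappa>' x t"
      using QE[OF \<open>r \<in> Q\<close>] by blast
    show "q + r \<in> Q"
      by (rule Q[where \<alpha> = "\<alpha> + \<alpha>'" and \<beta> = "\<beta> + \<beta>'" and \<gamma> = "\<gamma> + \<gamma>'" and \<mu> = "\<mu> + \<mu>'" and \<kappa> = "\<kappa> + \<kappa>'"])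
        (use 1 2 in \<open>simp_all add: inner_add_left lp_combination_add\<close>)
  next
    fix q and c :: real assume "q \<in> Q" "0 \<le> c"
    obtain \<alpha> \<beta> \<gamma> \<mu> \<kappa> where 1: "\<And>i. 0 \<le> \<alpha> $ i" "\<And>i. 0 \<le> \<beta> $ i" "\<And>j. j \<in> J \<Longrightarrow> 0 \<le> \<gamma> $ j" "0 \<le> \<kappa>"
      "\<And>x t. q \<bullet> (x, t) = lp_combination I A b J C d \<alpha> \<beta> \<gamma> \<mu> \<kappa> x t"
      using QE[OF \<open>q \<in> Q\<close>] by blast
    show "c *\<^sub>R q \<in> Q"
      by (rule Q[where \<alpha> = "c *\<^sub>R \<alpha>" and \<beta> = "c *\<^sub>R \<beta>" and \<gamma> = "c *\<^sub>R \<gamma>" and \<mu> = "c *\<^sub>R \<mu>" and \<kappa> = "c * \<kappa>"])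
        (use 1 \<open>0 \<le> c\<close> in \<open>simp_all add: lp_combination_scaleR\<close>)
  qed
  \<comment> \<open>Coefficient vectors of the homogenized constraints. Equations enter with both
    signs because \<mu> is free; \<open>(0, 1)\<close> stands for the constraint that
    \<open>t\<close> is nonnegative.\<close>
  define G :: "((real^'n) \<times> real) set" where
    "G = range (\<lambda>i. (axis i 1, 0)) \<union> range (\<lambda>i. (- axis i 1, 1)) \<union> (\<lambda>j. (- C $ j, d $ j)) ` J
       \<union> (\<lambda>k. (A $ k, - b $ k)) ` I \<union> (\<lambda>k. (- A $ k, b $ k)) ` I \<union> {(0, 1)}"
  have row: "(M *v x) $ k = M $ k \<bullet> x" for M :: "real^'n^'m" and x k
    by (simp add: matrix_vector_mult_def inner_vec_def)
  have "G \<subseteq> Q"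
  proof -
    have "(axis i 1, 0) \<in> Q" for i
      by (rule Q[where \<alpha> = "axis i 1" and \<beta> = 0 and \<gamma> = 0 and \<mu> = 0 and \<kappa> = 0])
        (simp_all add: lp_combination_def inner_axis' sum_axis, simp_all add: axis_def)
    moreover have "(- axis i 1, 1) \<in> Q" for i
      by (rule Q[where \<alpha> = 0 and \<beta> = "axis i 1" and \<gamma> = 0 and \<mu> = 0 and \<kappa> = 0])
        (simp_all add: lp_combination_def inner_axis' sum_axis, simp_all add: axis_def)
    moreover have "(- C $ j, d $ j) \<in> Q" if "j \<in> J" for j
      by (rule Q[where \<alpha> = 0 and \<beta> = 0 and \<gamma> = "axis j 1" and \<mu> = 0 and \<kappa> = 0])
        (use that in \<open>simp_all add: lp_combination_def sum_axis row, simp_all add: axis_def\<close>)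
    moreover have "(A $ k, - b $ k) \<in> Q" if "k \<in> I" for k
      by (rule Q[where \<alpha> = 0 and \<beta> = 0 and \<gamma> = 0 and \<mu> = "axis k 1" and \<kappa> = 0])
        (use that in \<open>simp_all add: lp_combination_def sum_axis row\<close>)
    moreover have "(- A $ k, b $ k) \<in> Q" if "k \<in> I" for k
      by (rule Q[where \<alpha> = 0 and \<beta> = 0 and \<gamma> = 0 and \<mu> = "- axis k 1" and \<kappa> = 0])
        (use that in \<open>simp_all add: lp_combination_def sum_axis row sum_negf\<close>)
    moreover have "(0, 1) \<in> Q"
      by (rule Q[where \<alpha> = 0 and \<beta> = 0 and \<gamma> = 0 and \<mu> = 0 and \<kappa> = 1])
        (auto simp: lp_combination_def)
    ultimately show ?thesis
      by (auto simp: G_def)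
  qed
  have "p \<in> convex_cone hull G"
  proof (rule mem_finite_convex_cone_hull)
    show "finite G" by (simp add: G_def)
  next
    fix a assume a: "\<And>g. g \<in> G \<Longrightarrow> 0 \<le> a \<bullet> g"
    \<comment> \<open>Nonnegativity on the generators says that \<open>v\<close> satisfies the
      constraints with right-hand sides scaled by \<tau>.\<close>
    obtain v \<tau> where vt: "a = (v, \<tau>)" by (cases a)
    have \<tau>: "0 \<le> \<tau>"
      using a[of "(0, 1)"] by (simp add: G_def vt)
    have v0: "0 \<le> v $ i" "v $ i \<le> \<tau>" for i
      using a[of "(axis i 1, 0)"] a[of "(- axis i 1, 1)"] by (auto simp: G_def vt inner_axis)
    have vC: "(C *v v) $ j \<le> \<tau> * d $ j" if "j \<in> J" for j
      using a[of "(- C $ j, d $ j)"] that by (auto simp: G_def vt row inner_commute)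
    have vA: "(A *v v) $ k = \<tau> * b $ k" if "k \<in> I" for k
      using a[of "(A $ k, - b $ k)"] a[of "(- A $ k, b $ k)"] that
      by (auto simp: G_def vt row inner_commute)
    text \<open>The points \<open>(xh + m v) / (1 + m \<tau>)\<close> are feasible for all \<open>m \<ge> 0\<close>.\<close>
    have ray: "0 \<le> p \<bullet> (xh, 1) + m * (p \<bullet> a)" if m: "0 \<le> m" for m
    proof -
      define t where "t = 1 + m * \<tau>"
      have t: "t > 0" using m \<tau> by (auto simp: t_def intro: add_pos_nonneg)
      define x where "x = (1 / t) *\<^sub>R (xh + m *\<^sub>R v)"
      have "x \<in> lp_relaxation I A b J C d"
      proof -
        have "0 \<le> x $ i \<and> x $ i \<le> 1" for i
        proof -
          have "m * v $ i \<le> m * \<tau>" "0 \<le> m * v $ i"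
            using v0 m by (auto intro: mult_left_mono)
          moreover have "0 \<le> xh $ i" "xh $ i \<le> 1"
            using xh by (auto simp: lp_relaxation_def)
          ultimately have "0 \<le> xh $ i + m * v $ i" "xh $ i + m * v $ i \<le> t"
            by (auto simp: t_def)
          then show ?thesis
            using t by (simp add: x_def)
        qed
        moreover have "(C *v x) $ j \<le> d $ j" if "j \<in> J" for j
        proof -
          have "(C *v xh) $ j + m * (C *v v) $ j \<le> d $ j + m * (\<tau> * d $ j)"
            using xh vC[OF that] that m by (intro add_mono mult_left_mono) (auto simp: lp_relaxation_def)
          also have "\<dots> = t * d $ j" by (simp add: t_def algebra_simps)
          finally show ?thesis
            using t by (simp add: x_def matrix_vector_right_distrib matrix_vector_mult_scaleR field_simps)
        qed
        moreover have "(A *v x) $ k = b $ k" if "k \<in> I" for k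
        proof -
          have "(A *v xh) $ k + m * (A *v v) $ k = t * b $ k"
            using xh vA[OF that] that by (auto simp: lp_relaxation_def t_def algebra_simps)
          then show ?thesis
            using t by (simp add: x_def matrix_vector_right_distrib matrix_vector_mult_scaleR field_simps)
        qed
        ultimately show ?thesis by (auto simp: lp_relaxation_def)
      qed
      then have "0 \<le> t * (p \<bullet> (x, 1))"
        using p t by simp
      also have "t * (p \<bullet> (x, 1)) = p \<bullet> (t *\<^sub>R (x, 1))" by (simp only: inner_scaleR_right)
      also have "t *\<^sub>R (x, 1) = (xh, 1) + m *\<^sub>R a"
        using t by (simp add: x_def vt t_def)
      finally show ?thesis by (simp add: inner_add_right)
    qed
    show "0 \<le> a \<bullet> p"
    proof (rule ccontr)
      assume "\<not> 0 \<le> a \<bullet> p"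
      then have neg: "p \<bullet> a < 0" by (simp add: inner_commute)
      have "0 \<le> p \<bullet> (xh, 1)" using p[OF xh] .
      \<comment> \<open>For this \<open>m\<close> the right-hand side of \<open>ray\<close> equals
        -1.\<close>
      then have "0 \<le> (p \<bullet> (xh, 1) + 1) / - (p \<bullet> a)"
        using neg by (intro divide_nonneg_pos) auto
      from ray[OF this] neg show False by simp
    qed
  qed
  also have "convex_cone hull G \<subseteq> Q"
    using \<open>G \<subseteq> Q\<close> \<open>convex_cone Q\<close> by (rule hull_minimal)
  finally show ?thesis by (rule QE)
qed

text \<open>The sum of the constraints tight at \<open>xh\<close> vanishes on the whole relaxation.
  Its negative is therefore nonnegative there, and Farkas' lemma writes it as another combination of
  the constraints. Adding the two gives zero, with multipliers at least 1 on every tight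
  constraint.\<close>

lemma lp_strictly_complementary_certificate:
  fixes A :: "real^'n^'p" and C :: "real^'n^'q"
  assumes xh: "xh \<in> rel_interior (lp_relaxation I A b J C d)"
  obtains \<alpha> \<beta> \<gamma> \<mu> where
    "\<And>i. 0 \<le> \<alpha> $ i" "\<And>i. 0 \<le> \<beta> $ i" "\<And>j. j \<in> J \<Longrightarrow> 0 \<le> \<gamma> $ j"
    "\<And>i. xh $ i = 0 \<Longrightarrow> 0 < \<alpha> $ i" "\<And>i. xh $ i = 1 \<Longrightarrow> 0 < \<beta> $ i"
    "\<And>j. j \<in> J \<Longrightarrow> (C *v xh) $ j = d $ j \<Longrightarrow> 0 < \<gamma> $ j"
    "\<And>x t. lp_combination I A b J C d \<alpha> \<beta> \<gamma> \<mu> 0 x t = 0"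
proof -
  let ?P = "lp_relaxation I A b J C d"
  let ?L = "lp_combination I A b J C d"
  have xhP: "xh \<in> ?P"
    using xh rel_interior_subset by blast
  define \<alpha>0 where "\<alpha>0 = (\<chi> i. if xh $ i = 0 then 1 else (0::real))"
  define \<beta>0 where "\<beta>0 = (\<chi> i. if xh $ i = 1 then 1 else (0::real))"
  define \<gamma>0 where "\<gamma>0 = (\<chi> j. if j \<in> J \<and> (C *v xh) $ j = d $ j then 1 else (0::real))"
  have "?L \<alpha>0 \<beta>0 \<gamma>0 0 0 xh 1 = 0"
  proof -
    have "(\<Sum>i\<in>UNIV. \<alpha>0 $ i * xh $ i) = 0" "(\<Sum>i\<in>UNIV. \<beta>0 $ i * (1 - xh $ i)) = 0"
      "(\<Sum>j\<in>J. \<gamma>0 $ j * (1 * d $ j - (C *v xh) $ j)) = 0"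
      by (auto simp: \<alpha>0_def \<beta>0_def \<gamma>0_def intro!: sum.neutral)
    then show ?thesis by (simp add: lp_combination_def)
  qed
  have tight: "?L \<alpha>0 \<beta>0 \<gamma>0 0 0 x 1 = 0" if "x \<in> ?P" for x
  proof (rule rel_interior_zero_imp_zero[OF convex_lp_relaxation xh])
    show "0 \<le> ?L \<alpha>0 \<beta>0 \<gamma>0 0 0 x 1" if "x \<in> ?P" for x
      using that by (rule lp_combination_nonneg) (auto simp: \<alpha>0_def \<beta>0_def \<gamma>0_def)
  qed (fact that lp_combination_affine \<open>?L \<alpha>0 \<beta>0 \<gamma>0 0 0 xh 1 = 0\<close>)+
  \<comment> \<open>Coefficient vector of minus the sum of the tight constraints, as a functional of
    \<open>(x, t)\<close>.\<close>
  define p where "p = - (\<alpha>0 - \<beta>0 - \<gamma>0 v* C, (\<Sum>i\<in>UNIV. \<beta>0 $ i) + \<gamma>0 \<bullet> d)"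
  have p: "p \<bullet> (x, t) = - ?L \<alpha>0 \<beta>0 \<gamma>0 0 0 x t" for x t
  proof -
    have "(\<Sum>j\<in>J. \<gamma>0 $ j * (t * d $ j - (C *v x) $ j)) = (\<Sum>j\<in>UNIV. \<gamma>0 $ j * (t * d $ j - (C *v x) $ j))"
      by (rule sum.mono_neutral_left) (auto simp: \<gamma>0_def)
    also have "\<dots> = \<gamma>0 \<bullet> (t *\<^sub>R d - C *v x)"
      by (simp add: inner_vec_def)
    also have "\<dots> = t * (\<gamma>0 \<bullet> d) - (\<gamma>0 v* C) \<bullet> x"
      by (simp add: inner_diff_right dot_lmul_matrix)
    finally have "(\<Sum>j\<in>J. \<gamma>0 $ j * (t * d $ j - (C *v x) $ j)) = t * (\<gamma>0 \<bullet> d) - (\<gamma>0 v* C) \<bullet> x" .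
    moreover have "(\<Sum>i\<in>UNIV. \<beta>0 $ i * (t - x $ i)) = t * (\<Sum>i\<in>UNIV. \<beta>0 $ i) - \<beta>0 \<bullet> x"
      by (simp add: inner_vec_def right_diff_distrib sum_subtractf sum_distrib_left mult.commute)
    moreover have "(\<Sum>i\<in>UNIV. \<alpha>0 $ i * x $ i) = \<alpha>0 \<bullet> x"
      by (simp add: inner_vec_def)
    moreover have "p \<bullet> (x, t) = - (\<alpha>0 \<bullet> x - \<beta>0 \<bullet> x - (\<gamma>0 v* C) \<bullet> x + ((\<Sum>i\<in>UNIV. \<beta>0 $ i) + \<gamma>0 \<bullet> d) * t)"
      by (simp add: p_def inner_diff_left) (simp add: algebra_simps)
    ultimately show ?thesis
      unfolding lp_combination_def by (simp add: algebra_simps)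
  qed
  have "0 \<le> p \<bullet> (x, 1)" if "x \<in> ?P" for x
    using tight[OF that] by (simp add: p)
  from affine_farkas_lp_relaxation[OF xhP this] obtain \<alpha> \<beta> \<gamma> \<mu> \<kappa> where
    nonneg: "\<And>i. 0 \<le> \<alpha> $ i" "\<And>i. 0 \<le> \<beta> $ i" "\<And>j. j \<in> J \<Longrightarrow> 0 \<le> \<gamma> $ j" "0 \<le> \<kappa>"
    and eq: "\<And>x t. p \<bullet> (x, t) = ?L \<alpha> \<beta> \<gamma> \<mu> \<kappa> x t"
    by blast
  have "?L \<alpha> \<beta> \<gamma> \<mu> \<kappa> xh 1 = 0"
    using eq[of xh 1] tight[OF xhP] by (simp add: p)
  \<comment> \<open>The combination is at least \<kappa> at \<open>xh\<close>, but its value there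
    is 0.\<close>
  then have "\<kappa> = 0"
    using lp_combination_nonneg[OF xhP nonneg(1-3), of \<kappa> \<mu>] nonneg(4) by simp
  then have zero: "?L (\<alpha> + \<alpha>0) (\<beta> + \<beta>0) (\<gamma> + \<gamma>0) \<mu> 0 x t = 0" for x t
    using eq[of x t] lp_combination_add[of I A b J C d \<alpha> \<alpha>0 \<beta> \<beta>0 \<gamma> \<gamma>0 \<mu> 0 0 0 x t]
    by (simp add: p)
  show thesis
    by (rule that[of "\<alpha> + \<alpha>0" "\<beta> + \<beta>0" "\<gamma> + \<gamma>0" \<mu>])
      (use nonneg zero in \<open>auto simp: \<alpha>0_def \<beta>0_def \<gamma>0_def intro: add_nonneg_pos\<close>)
qed

section \<open>The singularity degree of the Shor relaxation\<close>

lemma inner_restrict_vec: "v \<bullet> restrict_vec J w = (\<Sum>j\<in>J. v $ j * w $ j)"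
proof -
  have "v \<bullet> restrict_vec J w = (\<Sum>j\<in>UNIV. if j \<in> J then v $ j * w $ j else 0)"
    by (auto simp: inner_vec_def restrict_vec_def intro!: sum.cong)
  then show ?thesis by (simp add: sum.If_cases)
qed

text \<open>The first entry, for the equation on the corner entry of \<open>Y\<close>, is chosen to
  make the product with the right-hand side vanish. The entry \<open>\<alpha> + \<beta>\<close>
  multiplies \<open>X_ii - x_i\<close>.\<close>

definition shor_multiplier ::
  "'p set \<Rightarrow> real^'p \<Rightarrow> 'q set \<Rightarrow> real^'q \<Rightarrow> real^'n \<Rightarrow> real^'n \<Rightarrow> real^'q \<Rightarrow> real^'p \<Rightarrow>
    real \<times> (real^'n) \<times> (real^'p) \<times> (real^'q)" where
  "shor_multiplier I b J d \<alpha> \<beta> \<gamma> \<mu> =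
     ((\<Sum>k\<in>I. \<mu> $ k * b $ k) - (\<Sum>j\<in>J. \<gamma> $ j * d $ j), \<alpha> + \<beta>, - \<mu>, \<gamma>)"

lemma shor_rhs_inner_multiplier: "shor_rhs I b J d \<bullet> shor_multiplier I b J d \<alpha> \<beta> \<gamma> \<mu> = 0"
  unfolding inner_commute[of "shor_rhs I b J d"]
  by (simp add: shor_rhs_def shor_multiplier_def inner_restrict_vec sum_negf)

text \<open>The vanishing combination is added with \<open>x\<close> the block of \<open>Y\<close>
  and \<open>t\<close> its corner entry: the terms of \<open>A\<close>, \<open>C\<close>,
  \<open>b\<close> and \<open>d\<close> cancel, and \<open>X_ii - x_i\<close> turns
  \<open>x_i\<close> into \<open>X_ii\<close> and \<open>t - x_i\<close> into
  \<open>t - 2 x_i + X_ii\<close>.\<close>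

lemma shor_multiplier_inner_map:
  assumes "\<And>x t. lp_combination I A b J C d \<alpha> \<beta> \<gamma> \<mu> 0 x t = 0"
  shows "shor_multiplier I b J d \<alpha> \<beta> \<gamma> \<mu> \<bullet> shor_map I A J C (Y, s) =
    (\<Sum>i\<in>UNIV. \<alpha> $ i * Y $ Some i $ Some i)
    + (\<Sum>i\<in>UNIV. \<beta> $ i * (Y $ None $ None - 2 * Y $ Some i $ None + Y $ Some i $ Some i))
    + (\<Sum>j\<in>J. \<gamma> $ j * s $ j)"
proof -
  let ?x = "block_vec Y" and ?t = "Y $ None $ None"
  have "(\<Sum>i\<in>UNIV. (\<alpha> + \<beta>) $ i * (Y $ Some i $ Some i - ?x $ i))
      + ((\<Sum>i\<in>UNIV. \<alpha> $ i * ?x $ i) + (\<Sum>i\<in>UNIV. \<beta> $ i * (?t - ?x $ i)))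
    = (\<Sum>i\<in>UNIV. \<alpha> $ i * Y $ Some i $ Some i)
      + (\<Sum>i\<in>UNIV. \<beta> $ i * (?t - 2 * Y $ Some i $ None + Y $ Some i $ Some i))"
    unfolding sum.distrib[symmetric]
    by (intro sum.cong) (simp_all add: block_vec_def algebra_simps)
  moreover have "(\<Sum>j\<in>J. \<gamma> $ j * (C *v ?x + s) $ j) + (\<Sum>j\<in>J. \<gamma> $ j * (?t * d $ j - (C *v ?x) $ j))
    = (\<Sum>j\<in>J. \<gamma> $ j * s $ j) + (\<Sum>j\<in>J. \<gamma> $ j * d $ j) * ?t"
    unfolding sum_distrib_right sum.distrib[symmetric]
    by (intro sum.cong) (simp_all add: algebra_simps)
  moreover have "(\<Sum>k\<in>I. \<mu> $ k * ((A *v ?x) $ k - ?t * b $ k)) + (\<Sum>k\<in>I. \<mu> $ k * b $ k) * ?t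
    = (\<Sum>k\<in>I. \<mu> $ k * (A *v ?x) $ k)"
    unfolding sum_distrib_right sum.distrib[symmetric]
    by (intro sum.cong) (simp_all add: algebra_simps)
  moreover have "shor_multiplier I b J d \<alpha> \<beta> \<gamma> \<mu> \<bullet> shor_map I A J C (Y, s) =
      (\<Sum>k\<in>I. \<mu> $ k * b $ k) * ?t - (\<Sum>j\<in>J. \<gamma> $ j * d $ j) * ?t
      + (\<Sum>i\<in>UNIV. (\<alpha> + \<beta>) $ i * (Y $ Some i $ Some i - ?x $ i))
      - (\<Sum>k\<in>I. \<mu> $ k * (A *v ?x) $ k) + (\<Sum>j\<in>J. \<gamma> $ j * (C *v ?x + s) $ j)"
    unfolding shor_multiplier_def shor_map_def prod.case inner_Pair inner_minus_left inner_restrict_vec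
    by (simp add: inner_vec_def diag_vec_def block_mat_def left_diff_distrib sum_negf)
  ultimately show ?thesis
    using assms[of ?x ?t] unfolding lp_combination_def by linarith
qed

lemma psd_diag_nonneg:
  fixes Y :: "real^('n::finite option)^('n option)"
  assumes "Y \<in> psd_cone"
  shows "0 \<le> Y $ Some i $ Some i"
    and "0 \<le> Y $ None $ None - 2 * Y $ Some i $ None + Y $ Some i $ Some i"
proof -
  have "0 \<le> Y $ Some i $ Some i - 2 * c * Y $ Some i $ None + c\<^sup>2 * Y $ None $ None" for c
    using assms by (subst quadratic_form_axis_diff[symmetric]) (auto simp: psd_cone_def)
  from this[of 0] this[of 1] show "0 \<le> Y $ Some i $ Some i"
    and "0 \<le> Y $ None $ None - 2 * Y $ Some i $ None + Y $ Some i $ Some i"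
    by auto
qed

lemma mat_1_psd: "mat 1 \<in> psd_cone"
  by (simp add: psd_cone_def sym_matrices_def)

section \<open>Singularity degrees zero and one\<close>

lemma singularity_degree_eq_0:
  assumes "minimal_face K (feasible_set K L g) = K"
  shows "singularity_degree V K L g = 0"
proof -
  have "singularity_degree V K L g \<le> enat 0"
    unfolding singularity_degree_def using assms by (intro INF_lower) simp
  then show ?thesis by (simp flip: zero_enat_def)
qed

text \<open>A step cuts off some point of \<open>K\<close>, so the minimal face differs from
  \<open>K\<close> and zero steps do not reach it.\<close>

lemma singularity_degree_eq_1:
  assumes "facial_reduction_step V L g K (minimal_face K (feasible_set K L g))"
  shows "singularity_degree V K L g = 1"
proof (rule antisym)
  have "(facial_reduction_step V L g ^^ 1) K (minimal_face K (feasible_set K L g))"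
    using assms unfolding relpowp_1 .
  then have "singularity_degree V K L g \<le> enat 1"
    unfolding singularity_degree_def by (intro INF_lower) blast
  then show "singularity_degree V K L g \<le> 1"
    by (simp add: one_enat_def)
  have "minimal_face K (feasible_set K L g) \<noteq> K"
    using assms by (auto simp: facial_reduction_step_def)
  then have "1 \<le> k" if "(facial_reduction_step V L g ^^ k) K (minimal_face K (feasible_set K L g))" for k
    using that by (cases k) auto
  then show "1 \<le> singularity_degree V K L g"
    unfolding singularity_degree_def by (intro INF_greatest) (auto simp: one_enat_def)
qed

text \<open>On the cone the functional of the certificate is a sum of nonnegative terms. Where it
  vanishes, so does each term, and strict positivity on the tight constraints gives the hypotheses
  of \<open>mem_minimal_face_shor\<close>.\<close>

lemma shor_facial_reduction_step:
  fixes A :: "real^'n^'p" and C :: "real^'n^'q"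
  assumes xh: "xh \<in> rel_interior (lp_relaxation I A b J C d)"
    and tight: "(\<exists>i. xh $ i = 0 \<or> xh $ i = 1) \<or> (\<exists>j\<in>J. (C *v xh) $ j = d $ j)"
  shows "facial_reduction_step (shor_space J) (shor_map I A J C) (shor_rhs I b J d)
    (shor_cone J) (minimal_face (shor_cone J) (shor_relaxation I A b J C d))"
proof -
  let ?K = "shor_cone J :: ((real^('n option)^('n option)) \<times> (real^'q)) set"
  have xhP: "xh \<in> lp_relaxation I A b J C d"
    using xh rel_interior_subset by blast
  obtain \<alpha> \<beta> \<gamma> \<mu> where
    nonneg: "\<And>i. 0 \<le> \<alpha> $ i" "\<And>i. 0 \<le> \<beta> $ i" "\<And>j. j \<in> J \<Longrightarrow> 0 \<le> \<gamma> $ j"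
    and pos: "\<And>i. xh $ i = 0 \<Longrightarrow> 0 < \<alpha> $ i" "\<And>i. xh $ i = 1 \<Longrightarrow> 0 < \<beta> $ i"
      "\<And>j. j \<in> J \<Longrightarrow> (C *v xh) $ j = d $ j \<Longrightarrow> 0 < \<gamma> $ j"
    and zero: "\<And>x t. lp_combination I A b J C d \<alpha> \<beta> \<gamma> \<mu> 0 x t = 0"
  proof (rule lp_strictly_complementary_certificate[OF xh], goal_cases)
    case (1 \<alpha> \<beta> \<gamma> \<mu>)
    show ?case by (rule 1(1)) (fact 1(2-))+
  qed
  define y :: "real \<times> (real^'n) \<times> (real^'p) \<times> (real^'q)"
    where "y = shor_multiplier I b J d \<alpha> \<beta> \<gamma> \<mu>"
  have gy: "shor_rhs I b J d \<bullet> y = 0"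
    unfolding y_def by (rule shor_rhs_inner_multiplier)
  define w where "w = adjoint_on (shor_space J) (shor_map I A J C) y"
  have w: "w \<bullet> z = y \<bullet> shor_map I A J C z" if "z \<in> ?K" for z
    unfolding w_def
    by (rule adjoint_on(2)[OF subspace_shor_space linear_shor_map subsetD[OF shor_cone_subset that]])
  define D where "D Y i = Y $ None $ None - 2 * Y $ Some i $ None + Y $ Some i $ Some i"
    for Y :: "real^('n option)^('n option)" and i
  have w_eq: "w \<bullet> (Y, s) = (\<Sum>i\<in>UNIV. \<alpha> $ i * Y $ Some i $ Some i)
      + (\<Sum>i\<in>UNIV. \<beta> $ i * D Y i) + (\<Sum>j\<in>J. \<gamma> $ j * s $ j)" if "(Y, s) \<in> ?K" for Y s
    unfolding w[OF that] y_def D_def by (rule shor_multiplier_inner_map[OF zero])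
  have terms: "0 \<le> \<alpha> $ i * Y $ Some i $ Some i" "0 \<le> \<beta> $ i * D Y i" "j \<in> J \<Longrightarrow> 0 \<le> \<gamma> $ j * s $ j"
    if "(Y, s) \<in> ?K" for Y s i j
    using that nonneg psd_diag_nonneg[of Y] by (auto simp: shor_cone_def nonneg_orthant_def D_def)
  have sums: "0 \<le> (\<Sum>i\<in>UNIV. \<alpha> $ i * Y $ Some i $ Some i)"
      "0 \<le> (\<Sum>i\<in>UNIV. \<beta> $ i * D Y i)" "0 \<le> (\<Sum>j\<in>J. \<gamma> $ j * s $ j)"
    if "(Y, s) \<in> ?K" for Y s
    using terms[OF that] by (auto intro: sum_nonneg)
  have w_nonneg: "0 \<le> w \<bullet> z" if "z \<in> ?K" for z
  proof -
    obtain Y s where "z = (Y, s)" by (cases z)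
    with that sums[of Y s] show ?thesis by (simp add: w_eq)
  qed
  have terms_zero: "(\<forall>i. \<alpha> $ i * Y $ Some i $ Some i = 0) \<and> (\<forall>i. \<beta> $ i * D Y i = 0)
      \<and> (\<forall>j\<in>J. \<gamma> $ j * s $ j = 0)"
    if "(Y, s) \<in> ?K" "w \<bullet> (Y, s) = 0" for Y s
  proof -
    have "(\<Sum>i\<in>UNIV. \<alpha> $ i * Y $ Some i $ Some i) = 0" "(\<Sum>i\<in>UNIV. \<beta> $ i * D Y i) = 0"
      "(\<Sum>j\<in>J. \<gamma> $ j * s $ j) = 0"
      using that(2) sums[OF that(1)] unfolding w_eq[OF that(1)] by linarith+
    then show ?thesis
      using terms[OF that(1)] by (simp add: sum_nonneg_eq_0_iff)
  qed
  have face: "minimal_face ?K (shor_relaxation I A b J C d) = ?K \<inter> {z. w \<bullet> z = 0}"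
  proof
    show "minimal_face ?K (shor_relaxation I A b J C d) \<subseteq> ?K \<inter> {z. w \<bullet> z = 0}"
      unfolding minimal_face_def
    proof (rule hull_minimal)
      show "?K \<inter> {z. w \<bullet> z = 0} face_of ?K"
        using convex_cone_shor_cone w_nonneg
        by (intro face_of_Int_supporting_hyperplane_ge) (auto simp: convex_cone_def)
      show "shor_relaxation I A b J C d \<subseteq> ?K \<inter> {z. w \<bullet> z = 0}"
      proof
        fix z assume "z \<in> shor_relaxation I A b J C d"
        then have z: "z \<in> ?K" "shor_map I A J C z = shor_rhs I b J d"
          by (simp_all add: shor_relaxation_eq feasible_set_def)
        then have "w \<bullet> z = 0"
          using w[OF z(1)] gy by (simp add: inner_commute)
        with z show "z \<in> ?K \<inter> {z. w \<bullet> z = 0}" by simp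
      qed
    qed
    show "?K \<inter> {z. w \<bullet> z = 0} \<subseteq> minimal_face ?K (shor_relaxation I A b J C d)"
    proof (clarify, rule mem_minimal_face_shor[OF xhP])
      fix Y s assume z: "(Y, s) \<in> ?K" "w \<bullet> (Y, s) = 0"
      note 0 = terms_zero[OF z]
      show "Y $ Some i $ Some i = 0" if "xh $ i = 0" for i
        using conjunct1[OF 0] pos(1)[OF that] by (auto dest!: spec[of _ i])
      show "Y $ None $ None - 2 * Y $ Some i $ None + Y $ Some i $ Some i = 0" if "xh $ i = 1" for i
        using conjunct1[OF conjunct2[OF 0]] pos(2)[OF that] unfolding D_def by (auto dest!: spec[of _ i])
      show "s $ j = 0" if "j \<in> J" "(C *v xh) $ j = d $ j" for j
        using conjunct2[OF conjunct2[OF 0]] pos(3)[OF that] that(1) by (auto dest!: bspec[of _ _ j])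
    qed
  qed
  \<comment> \<open>At the identity matrix with unit slacks every expression weighted by a
    multiplier is positive, so a zero product would force all multipliers to vanish, although some
    constraint is tight.\<close>
  define z where "z = (mat 1 :: real^('n option)^('n option), (\<chi> j. if j \<in> J then 1 else 0) :: real^'q)"
  have z: "z \<in> ?K"
    by (auto simp: z_def shor_cone_def mat_1_psd nonneg_orthant_def vecs_on_def)
  have "w \<bullet> z \<noteq> 0"
  proof
    assume "w \<bullet> z = 0"
    then have "(\<forall>i. \<alpha> $ i = 0) \<and> (\<forall>i. \<beta> $ i = 0) \<and> (\<forall>j\<in>J. \<gamma> $ j = 0)"
      using terms_zero[of "fst z" "snd z"] z by (simp add: z_def D_def mat_def)
    with tight pos show False by force
  qed
  with z have "\<exists>z\<in>?K. w \<bullet> z \<noteq> 0" by blast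
  with gy w_nonneg face show ?thesis
    unfolding facial_reduction_step_def w_def by (intro exI[of _ y]) simp
qed

theorem theorem3p1:
  fixes A :: "real^'n^'p" and b :: "real^'p" and C :: "real^'n^'q" and d :: "real^'q"
    and I :: "'p set" and J :: "'q set"
  assumes "binary_set I A b J C d \<noteq> {}"
  shows "shor_relaxation I A b J C d =
           feasible_set (shor_cone J) (shor_map I A J C) (shor_rhs I b J d) \<and>
         singularity_degree (shor_space J) (shor_cone J) (shor_map I A J C) (shor_rhs I b J d) \<le> 1 \<and>
         singularity_degree (shor_space J) (shor_cone J) (shor_map I A J C) (shor_rhs I b J d) =
           (if \<exists>x \<in> lp_relaxation I A b J C d.
                 (\<forall>i. 0 < x $ i \<and> x $ i < 1) \<and> (\<forall>j\<in>J. (C *v x) $ j < d $ j)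
            then 0 else 1)"
proof -
  let ?P = "lp_relaxation I A b J C d"
  let ?sd = "singularity_degree (shor_space J) (shor_cone J) (shor_map I A J C) (shor_rhs I b J d)"
  let ?slater = "\<exists>x\<in>?P. (\<forall>i. 0 < x $ i \<and> x $ i < 1) \<and> (\<forall>j\<in>J. (C *v x) $ j < d $ j)"
  have "?sd = (if ?slater then 0 else 1)"
  proof (cases ?slater)
    case True
    then obtain x where x: "x \<in> ?P" "\<And>i. 0 < x $ i \<and> x $ i < 1" "\<And>j. j \<in> J \<Longrightarrow> (C *v x) $ j < d $ j"
      by blast
    \<comment> \<open>No constraint is tight at \<open>x\<close>, so the conditions of
      \<open>mem_minimal_face_shor\<close> hold vacuously for the whole cone.\<close>
    have "shor_cone J \<subseteq> minimal_face (shor_cone J) (shor_relaxation I A b J C d)"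
    proof clarify
      fix Y s assume "(Y, s) \<in> (shor_cone J :: ((real^('n option)^('n option)) \<times> (real^'q)) set)"
      then show "(Y, s) \<in> minimal_face (shor_cone J) (shor_relaxation I A b J C d)"
      proof (rule mem_minimal_face_shor[OF x(1)])
        show "Y $ Some i $ Some i = 0" if "x $ i = 0" for i
          using x(2)[of i] that by simp
        show "Y $ None $ None - 2 * Y $ Some i $ None + Y $ Some i $ Some i = 0" if "x $ i = 1" for i
          using x(2)[of i] that by simp
        show "s $ j = 0" if "j \<in> J" "(C *v x) $ j = d $ j" for j
          using x(3)[of j] that by simp
      qed
    qed
    moreover have "minimal_face (shor_cone J) (shor_relaxation I A b J C d) \<subseteq> shor_cone J"
      unfolding minimal_face_def using convex_cone_shor_cone[of J]
      by (intro hull_minimal face_of_refl) (auto simp: shor_relaxation_eq feasible_set_def convex_cone_def)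
    ultimately have "minimal_face (shor_cone J) (shor_relaxation I A b J C d) = shor_cone J"
      by (rule antisym[rotated])
    then show ?thesis
      unfolding if_P[OF True] shor_relaxation_eq by (rule singularity_degree_eq_0)
  next
    case False
    from assms obtain x where x: "x \<in> binary_set I A b J C d" by blast
    have "x $ i \<in> {0..1}" for i
    proof -
      have "x $ i = 0 \<or> x $ i = 1" using x by (simp add: binary_set_def)
      then show ?thesis by auto
    qed
    with x have "?P \<noteq> {}"
      by (auto simp: binary_set_def lp_relaxation_def)
    then obtain xh where xh: "xh \<in> rel_interior ?P"
      using rel_interior_eq_empty[OF convex_lp_relaxation] by blast
    then have xhP: "xh \<in> ?P"
      using rel_interior_subset by blast
    \<comment> \<open>With nothing tight, \<open>xh\<close> itself would be a strict point of the
      relaxation.\<close>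
    have "(\<exists>i. xh $ i = 0 \<or> xh $ i = 1) \<or> (\<exists>j\<in>J. (C *v xh) $ j = d $ j)"
    proof (rule ccontr)
      assume no: "\<not> ?thesis"
      have "0 < xh $ i \<and> xh $ i < 1" for i
        using no xhP by (auto simp: lp_relaxation_def less_le)
      moreover have "(C *v xh) $ j < d $ j" if "j \<in> J" for j
        using no xhP that by (auto simp: lp_relaxation_def less_le)
      ultimately show False
        using False xhP by blast
    qed
    from shor_facial_reduction_step[OF xh this] show ?thesis
      unfolding if_not_P[OF False] shor_relaxation_eq by (rule singularity_degree_eq_1)
  qed
  moreover from this have "?sd \<le> 1"
    by (cases ?slater) (simp_all only: if_True if_False zero_le order_refl)
  ultimately show ?thesis
    using shor_relaxation_eq by blast
qed

end
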